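(* Let $X$ be a nonempty set, and let $\mathfrak{Q}=\{\mathcal{Q}_x\}_{x\in X}$, $\mathcal{Q}=\bigcup_{x\in X}\mathcal{Q}_x$ and the outer measure $\mu$ on $X$ be data satisfying (HL1) and (HL2) of the context. Suppose that the following condition is satisfied. (HL3) If $(Q_n)_n$ is an infinite sequence of pairwise disjoint members of $\mathcal{Q}$ with $\inf_n\mu(Q_n)>0$, then $\mu(\bigcup_nQ_n)=\infty$. (Note that this condition is automatically satisfied if the members of $\mathcal{Q}$ are Carathéodory measurable with respect to $\mu$.) Suppose that the constant $c>0$ satisfies the following condition. (HL4) There exists a constant $\lambda>1$ such that $\mu(\tilde{Q})\leq c\,\mu(Q)$ for every $Q\in\mathcal{Q}$, where $$\tilde{Q}:=\bigcup_{R\in\mathcal{Q},\;R\cap Q\neq\emptyset,\;\mu(R)\leq\lambda\mu(Q)}R.$$ Then $\mathscr{H}^{\mathfrak{Q}}_\mu\leq c$.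
   Context: Let $X$ be a nonempty set. (HL1) For every $x\in X$, $\mathcal{Q}_x$ is a nonempty set of subsets of $X$ such that $x\in Q$ for every $Q\in\mathcal{Q}_x$. Put $\mathfrak{Q}:=\{\mathcal{Q}_x\}_{x\in X}$ and $\mathcal{Q}:=\bigcup_{x}\mathcal{Q}_x$. (HL2) $\mu$ is an outer measure on $X$ such that $0<\mu(Q)<\infty$ for every $Q\in\mathcal{Q}$. For a set function $F:\mathcal{Q}\to[0,\infty]$ define the maximal function $\mathbf{M}^{\mathfrak{Q}}_\mu F:X\to[0,\infty]$ by $\mathbf{M}^{\mathfrak{Q}}_\mu F(x):=\sup_{Q\in\mathcal{Q}_x}\frac{F(Q)}{\mu(Q)}$, and the norm $$\|F\|_{\mathcal{Q}}:=\sup\Big\{\sum_{i=1}^nF(Q_i):Q_1,\ldots,Q_n\in\mathcal{Q},\ Q_i\cap Q_j=\emptyset\text{ for }i\neq j\Big\}.$$ The Hardy-Littlewood maximal constant $\mathscr{H}^{\mathfrak{Q}}_\mu$ is the smallest constant $c$ (the infimum of all finite $c>0$) such that $$\mu\{x\in X:\mathbf{M}^{\mathfrak{Q}}_\mu F(x)>r\}\leq c\,r^{-1}\|F\|_{\mathcal{Q}}$$ for every $r>0$ and every $F:\mathcal{Q}\to[0,\infty]$; $\mathscr{H}^{\mathfrak{Q}}_\mu:=\infty$ if no such finite $c$ exists. *)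

theory Defs
  imports "HOL-Analysis.Analysis"
begin

text \<open>
  \<open>QQ x\<close> is the collection of sets attached to the point \<open>x\<close>. A set function on the union
  of these collections over \<open>X\<close> is modelled by a total function \<open>F\<close>; its values elsewhere
  are never used.
\<close>

definition all_sets :: "'a set \<Rightarrow> ('a \<Rightarrow> 'a set set) \<Rightarrow> 'a set set" where
  "all_sets X QQ = (\<Union>x\<in>X. QQ x)"

definition maximal_fun ::
    "('a \<Rightarrow> 'a set set) \<Rightarrow> ('a set \<Rightarrow> ennreal) \<Rightarrow> ('a set \<Rightarrow> ennreal) \<Rightarrow> 'a \<Rightarrow> ennreal" where
  "maximal_fun QQ \<mu> F x = (SUP Q\<in>QQ x. F Q / \<mu> Q)"

definition set_fun_norm :: "'a set set \<Rightarrow> ('a set \<Rightarrow> ennreal) \<Rightarrow> ennreal" where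
  "set_fun_norm \<Q> F =
     Sup {\<Sum>i=1..n. F (Q i) | n Q.
            1 \<le> n \<and> (\<forall>i\<in>{1..n}. Q i \<in> \<Q>) \<and> disjoint_family_on Q {1..n::nat}}"

text \<open>
  The infimum of the empty set is \<open>\<infinity>\<close>, so this also covers the case that no finite
  constant is admissible.
\<close>

definition HL_maximal_constant ::
    "'a set \<Rightarrow> ('a \<Rightarrow> 'a set set) \<Rightarrow> ('a set \<Rightarrow> ennreal) \<Rightarrow> ennreal" where
  "HL_maximal_constant X QQ \<mu> =
     Inf {ennreal c | c :: real. 0 < c \<and>
            (\<forall>(r::real) F. 0 < r \<longrightarrow>
               \<mu> {x \<in> X. maximal_fun QQ \<mu> F x > ennreal r}
                 \<le> ennreal c * inverse (ennreal r) * set_fun_norm (all_sets X QQ) F)}"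

definition enlargement ::
    "'a set set \<Rightarrow> ('a set \<Rightarrow> ennreal) \<Rightarrow> real \<Rightarrow> 'a set \<Rightarrow> 'a set" where
  "enlargement \<Q> \<mu> \<Lambda> Q = \<Union>{R \<in> \<Q>. R \<inter> Q \<noteq> {} \<and> \<mu> R \<le> ennreal \<Lambda> * \<mu> Q}"

end

theory Submission
  imports Defs
begin

text \<open>
  Let \<open>\<A>\<close> be the family of all \<open>Q\<close> with \<open>F Q > r * \<mu> Q\<close>. Its members cover the set where
  the maximal function exceeds \<open>r\<close>, and disjoint members have total measure at most
  \<open>\<parallel>F\<parallel> / r\<close>. A maximal disjoint subfamily, chosen by Zorn's lemma so that whatever meets it meets
  a member of comparable measure, is therefore countable, and the enlargements of its members
  cover \<open>\<Union>\<A>\<close>.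
\<close>

text \<open>The supremum \<open>s\<close> of the values is positive and finite, so
  \<open>s / \<Lambda> < s\<close> and some value exceeds \<open>s / \<Lambda>\<close>. Such an
  element stands in for a largest one, which need not exist.\<close>

lemma nearly_maximal_element:
  fixes m :: "'b \<Rightarrow> real"
  assumes "B \<noteq> {}" and pos: "\<And>Q. Q \<in> B \<Longrightarrow> 0 < m Q" and bd: "\<And>Q. Q \<in> B \<Longrightarrow> m Q \<le> K"
    and "\<Lambda> > 1"
  obtains Q where "Q \<in> B" "\<And>R. R \<in> B \<Longrightarrow> m R \<le> \<Lambda> * m Q"
proof -
  have bdd: "bdd_above (m ` B)"
    using bd by (auto simp: bdd_above_def)
  obtain P where "P \<in> B"
    using \<open>B \<noteq> {}\<close> by blast
  then have "0 < (SUP Q\<in>B. m Q)"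
    using pos cSUP_upper[OF _ bdd] by (meson less_le_trans)
  then have "(SUP Q\<in>B. m Q) / \<Lambda> < (SUP Q\<in>B. m Q)"
    using \<open>\<Lambda> > 1\<close> by (simp add: divide_less_eq)
  then obtain Q where Q: "Q \<in> B" "(SUP Q\<in>B. m Q) / \<Lambda> < m Q"
    using less_cSUP_iff[OF \<open>B \<noteq> {}\<close> bdd] by blast
  then have "(SUP Q\<in>B. m Q) \<le> \<Lambda> * m Q"
    using \<open>\<Lambda> > 1\<close> by (simp add: divide_less_eq mult.commute)
  with Q(1) that show thesis
    using cSUP_upper[OF _ bdd] by (meson order_trans)
qed

text \<open>This is the greedy Vitali selection. An arbitrary maximal disjoint family might meet
  \<open>R\<close> only in sets far smaller than \<open>R\<close>, so Zorn's lemma is applied only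
  to disjoint families that already dominate every set they meet.\<close>

lemma maximal_dominating_disjoint_subfamily:
  fixes \<A> :: "'a set set" and m :: "'a set \<Rightarrow> real"
  assumes pos: "\<And>Q. Q \<in> \<A> \<Longrightarrow> 0 < m Q" and bd: "\<And>Q. Q \<in> \<A> \<Longrightarrow> m Q \<le> K"
    and ne: "{} \<notin> \<A>" and "\<Lambda> > 1"
  obtains \<D> where "\<D> \<subseteq> \<A>" "disjoint \<D>"
    "\<And>R. R \<in> \<A> \<Longrightarrow> \<exists>Q\<in>\<D>. R \<inter> Q \<noteq> {} \<and> m R \<le> \<Lambda> * m Q"
proof -
  define admissible where "admissible = {\<D>. \<D> \<subseteq> \<A> \<and> disjoint \<D> \<and>
    (\<forall>R\<in>\<A>. (\<exists>Q\<in>\<D>. R \<inter> Q \<noteq> {}) \<longrightarrow> (\<exists>Q\<in>\<D>. R \<inter> Q \<noteq> {} \<and> m R \<le> \<Lambda> * m Q))}"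
  have "\<exists>U\<in>admissible. \<forall>\<D>\<in>\<C>. \<D> \<subseteq> U" if "subset.chain admissible \<C>" for \<C>
  proof (intro bexI ballI)
    have sub: "\<C> \<subseteq> admissible" and ch: "\<And>D E. D \<in> \<C> \<Longrightarrow> E \<in> \<C> \<Longrightarrow> D \<subseteq> E \<or> E \<subseteq> D"
      using that by (auto simp: subset_chain_def)
    have "disjoint (\<Union>\<C>)"
    proof (rule disjointI)
      fix P Q assume "P \<in> \<Union>\<C>" "Q \<in> \<Union>\<C>" "P \<noteq> Q"
      then obtain D where "D \<in> \<C>" "P \<in> D" "Q \<in> D"
        using ch by blast
      with \<open>P \<noteq> Q\<close> show "P \<inter> Q = {}"
        using sub by (auto simp: admissible_def disjoint_def)
    qed
    \<comment> \<open>A set meeting the union meets one family of the chain, and the dominating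
      member provided by that family lies in the union.\<close>
    moreover have "\<exists>Q\<in>\<Union>\<C>. R \<inter> Q \<noteq> {} \<and> m R \<le> \<Lambda> * m Q"
      if R: "R \<in> \<A>" "Q \<in> \<Union>\<C>" "R \<inter> Q \<noteq> {}" for R Q
    proof -
      obtain D where "D \<in> \<C>" "Q \<in> D"
        using R by blast
      moreover from this have "D \<in> admissible"
        using sub by blast
      then have "\<exists>Q\<in>D. R \<inter> Q \<noteq> {} \<and> m R \<le> \<Lambda> * m Q"
        using R \<open>Q \<in> D\<close> unfolding admissible_def by blast
      ultimately show ?thesis by blast
    qed
    ultimately show "\<Union>\<C> \<in> admissible"
      using sub by (auto simp: admissible_def)
  qed blast
  from subset_Zorn[of admissible, OF this] obtain \<D> where "\<D> \<in> admissible"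
    and max: "\<And>E. E \<in> admissible \<Longrightarrow> \<D> \<subseteq> E \<Longrightarrow> E = \<D>"
    by blast
  then have sub: "\<D> \<subseteq> \<A>" and disj: "disjoint \<D>"
    and dom: "\<And>R. R \<in> \<A> \<Longrightarrow> \<exists>Q\<in>\<D>. R \<inter> Q \<noteq> {} \<Longrightarrow> \<exists>Q\<in>\<D>. R \<inter> Q \<noteq> {} \<and> m R \<le> \<Lambda> * m Q"
    by (auto simp: admissible_def)
  define B where "B = {R\<in>\<A>. \<forall>Q\<in>\<D>. R \<inter> Q = {}}"
  have "B = {}"
  proof (rule ccontr)
    assume "B \<noteq> {}"
    then obtain P where P: "P \<in> B" "\<And>R. R \<in> B \<Longrightarrow> m R \<le> \<Lambda> * m P"
      using nearly_maximal_element[of B m K \<Lambda>] pos bd \<open>\<Lambda> > 1\<close> by (auto simp: B_def)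
    \<comment> \<open>A set in \<open>B\<close> misses \<open>\<D>\<close>, so it can only meet
      \<open>P\<close>, which dominates it by choice. A set outside \<open>B\<close> is already
      dominated within \<open>\<D>\<close>.\<close>
    have "\<exists>Q\<in>insert P \<D>. R \<inter> Q \<noteq> {} \<and> m R \<le> \<Lambda> * m Q"
      if "R \<in> \<A>" "\<exists>Q\<in>insert P \<D>. R \<inter> Q \<noteq> {}" for R
    proof (cases "R \<in> B")
      case True
      then show ?thesis using P(2) that by (auto simp: B_def)
    next
      case False
      then show ?thesis using dom that(1) by (auto simp: B_def)
    qed
    moreover have "disjoint (insert P \<D>)"
      using disj P(1) by (auto simp: disjoint_def B_def)
    ultimately have "insert P \<D> \<in> admissible"
      using sub P(1) unfolding admissible_def by (auto simp: B_def)
    \<comment> \<open>Since \<open>P\<close> misses every member of \<open>\<D>\<close>, it would be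
      disjoint from itself, hence empty.\<close>
    then have "P \<in> \<D>"
      using max by blast
    then show False
      using P(1) ne by (auto simp: B_def)
  qed
  with sub disj dom that[of \<D>] show thesis
    by (auto simp: B_def)
qed

text \<open>Bounded finite sums make \<open>m\<close> summable on \<open>D\<close>, and a summable
  real family has countable support. Positivity makes the support all of \<open>D\<close>.\<close>

lemma countable_if_finite_sums_bounded:
  fixes m :: "'b \<Rightarrow> real"
  assumes "\<And>x. x \<in> D \<Longrightarrow> 0 < m x" and "\<And>S. finite S \<Longrightarrow> S \<subseteq> D \<Longrightarrow> sum m S \<le> K"
  shows "countable D"
proof -
  have "m summable_on D"
    using assms by (intro nonneg_bdd_above_summable_on) (auto simp: bdd_above_def less_imp_le)
  then have "countable {x\<in>D. m x \<noteq> 0}"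
    by (rule summable_countable_real)
  moreover have "{x\<in>D. m x \<noteq> 0} = D"
    using assms(1) by force
  ultimately show ?thesis by simp
qed

text \<open>The sets \<open>T Q\<close> may overlap, while \<open>countably_subadditive\<close>
  speaks of disjoint sequences only. The cover is therefore made disjoint first, and monotonicity
  compares the pieces with the original sets.\<close>

lemma outer_measure_countable_cover_le:
  fixes \<mu> :: "'a set \<Rightarrow> ennreal"
  assumes outer: "outer_measure_space (Pow X) \<mu>" and "countable D"
    and T: "\<And>Q. Q \<in> D \<Longrightarrow> T Q \<subseteq> X" and cover: "E \<subseteq> (\<Union>Q\<in>D. T Q)"
    and le: "\<And>S. finite S \<Longrightarrow> S \<subseteq> D \<Longrightarrow> (\<Sum>Q\<in>S. \<mu> (T Q)) \<le> K"
  shows "\<mu> E \<le> K"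
proof -
  have empty: "\<mu> {} = 0" and inc: "increasing (Pow X) \<mu>"
    and subadd: "countably_subadditive (Pow X) \<mu>"
    using outer by (auto simp: outer_measure_space_def positive_def)
  define I where "I = to_nat_on D ` D"
  \<comment> \<open>\<open>D\<close> may be finite, so indices that encode no member receive the
    empty set, of measure 0.\<close>
  define B where "B n = (if n \<in> I then T (from_nat_into D n) else {})" for n
  have inj: "inj_on (from_nat_into D) I" and img: "from_nat_into D ` I = D"
    using \<open>countable D\<close> by (auto simp: I_def inj_on_def image_image)
  have BX: "B n \<subseteq> X" for n
    using T img by (auto simp: B_def)
  have U: "(\<Union>Q\<in>D. T Q) = (\<Union>n. B n)"
  proof -
    have "(\<Union>Q\<in>D. T Q) = (\<Union>n\<in>I. T (from_nat_into D n))"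
      by (subst (1) img[symmetric]) (simp only: image_image)
    also have "\<dots> = (\<Union>n. B n)"
      by (auto simp: B_def split: if_splits)
    finally show ?thesis .
  qed
  have "(\<Sum>n<N. \<mu> (B n)) \<le> K" for N
  proof -
    have "(\<Sum>n<N. \<mu> (B n)) = (\<Sum>n\<in>{..<N} \<inter> I. \<mu> (T (from_nat_into D n)))"
      by (subst sum.inter_restrict) (auto simp: B_def empty intro: sum.cong)
    also have "\<dots> = (\<Sum>Q\<in>from_nat_into D ` ({..<N} \<inter> I). \<mu> (T Q))"
      using inj by (subst sum.reindex) (auto intro: inj_on_subset)
    also have "\<dots> \<le> K"
      using img by (intro le) auto
    finally show ?thesis .
  qed
  then have sum: "(\<Sum>n. \<mu> (B n)) \<le> K"
    by (auto intro: suminf_le_const)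
  have dis: "disjointed B n \<subseteq> B n" for n
    by (rule disjointed_subset)
  have "\<mu> E \<le> \<mu> (\<Union>n. disjointed B n)"
    using cover BX unfolding U UN_disjointed_eq by (auto intro!: increasingD[OF inc])
  also have "\<dots> \<le> (\<Sum>n. \<mu> (disjointed B n))"
  proof -
    have "range (disjointed B) \<subseteq> Pow X" "(\<Union>n. disjointed B n) \<in> Pow X"
      using BX dis by blast+
    then show ?thesis
      using subadd disjoint_family_disjointed[of B] unfolding countably_subadditive_def by blast
  qed
  also have "\<dots> \<le> (\<Sum>n. \<mu> (B n))"
  proof (intro suminf_le summableI)
    show "\<mu> (disjointed B n) \<le> \<mu> (B n)" for n
      using BX[of n] dis[of n] by (intro increasingD[OF inc]) auto
  qed
  also note sum
  finally show ?thesis .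
qed

lemma sum_le_set_fun_norm:
  assumes "finite S" "S \<subseteq> \<Q>" "disjoint S"
  shows "sum F S \<le> set_fun_norm \<Q> F"
proof (cases "S = {}")
  case False
  obtain h where h: "bij_betw h {1..card S} S"
    using ex_bij_betw_nat_finite_1[OF \<open>finite S\<close>] by blast
  have "sum F S = (\<Sum>i=1..card S. F (h i))"
    using sum.reindex_bij_betw[OF h] by metis
  moreover have "1 \<le> card S"
    using False \<open>finite S\<close> by (simp add: Suc_leI card_gt_0_iff)
  moreover have "\<forall>i\<in>{1..card S}. h i \<in> \<Q>"
    using h \<open>S \<subseteq> \<Q>\<close> by (auto simp: bij_betw_def)
  moreover have "disjoint_family_on h {1..card S}"
    using h \<open>disjoint S\<close> unfolding disjoint_family_on_def disjoint_def bij_betw_def inj_on_def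
    by (metis imageI)
  ultimately show ?thesis
    unfolding set_fun_norm_def by (intro Sup_upper) blast
qed simp

text \<open>With \<open>N\<close> the norm of \<open>F\<close> divided by \<open>r\<close>, the
  selected disjoint sets have total measure at most \<open>N\<close>, so their enlargements, which
  cover the level set, contribute at most \<open>c\<close> times \<open>N\<close>.\<close>

lemma maximal_inequality:
  fixes \<mu> :: "'a set \<Rightarrow> ennreal" and r c \<Lambda> :: real
  assumes HL1: "\<And>x Q. x \<in> X \<Longrightarrow> Q \<in> QQ x \<Longrightarrow> Q \<subseteq> X \<and> x \<in> Q"
    and outer: "outer_measure_space (Pow X) \<mu>"
    and pos_fin: "\<And>Q. Q \<in> all_sets X QQ \<Longrightarrow> 0 < \<mu> Q \<and> \<mu> Q < \<infinity>"
    and "\<Lambda> > 1"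
    and enl: "\<And>Q. Q \<in> all_sets X QQ \<Longrightarrow>
      \<mu> (enlargement (all_sets X QQ) \<mu> \<Lambda> Q) \<le> ennreal c * \<mu> Q"
    and "c > 0" "r > 0"
  shows "\<mu> {x\<in>X. maximal_fun QQ \<mu> F x > ennreal r}
           \<le> ennreal c * inverse (ennreal r) * set_fun_norm (all_sets X QQ) F"
proof -
  define \<Q> where "\<Q> = all_sets X QQ"
  define N where "N = inverse (ennreal r) * set_fun_norm \<Q> F"
  define \<A> where "\<A> = {Q\<in>\<Q>. ennreal r < F Q / \<mu> Q}"
  have \<A>sub: "\<A> \<subseteq> \<Q>"
    by (auto simp: \<A>_def)
  have sum_le: "sum \<mu> S \<le> N" if S: "finite S" "S \<subseteq> \<A>" "disjoint S" for S
  proof -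
    have "ennreal r * \<mu> Q \<le> F Q" if "Q \<in> S" for Q
    proof -
      have "0 < \<mu> Q" "\<mu> Q < \<infinity>" "ennreal r \<le> F Q / \<mu> Q"
        using that S pos_fin by (auto simp: \<A>_def \<Q>_def less_imp_le)
      then have "ennreal r * \<mu> Q \<le> F Q / \<mu> Q * \<mu> Q"
        by (intro mult_right_mono) auto
      \<comment> \<open>Cancellation in \<open>ennreal\<close> requires that \<open>\<mu> Q\<close>
        be neither 0 nor infinite.\<close>
      also have "\<dots> = F Q"
        using \<open>0 < \<mu> Q\<close> \<open>\<mu> Q < \<infinity>\<close>
        by (simp add: ennreal_divide_times ennreal_times_divide[symmetric] mult_divide_eq_ennreal)
      finally show ?thesis .
    qed
    then have "ennreal r * sum \<mu> S \<le> sum F S"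
      by (simp add: sum_distrib_left sum_mono)
    also have "\<dots> \<le> set_fun_norm \<Q> F"
      using S \<A>sub by (intro sum_le_set_fun_norm) auto
    finally have "inverse (ennreal r) * (ennreal r * sum \<mu> S) \<le> N"
      unfolding N_def by (rule mult_left_mono) simp
    moreover have "inverse (ennreal r) * ennreal r = 1"
      using \<open>r > 0\<close> by (simp add: inverse_ennreal ennreal_mult[symmetric])
    ultimately show ?thesis
      by (simp add: mult.assoc[symmetric])
  qed
  show ?thesis
  \<comment> \<open>An infinite \<open>N\<close> makes the right-hand side infinite, as
    \<open>c > 0\<close>. A finite \<open>N\<close> is the real bound needed for the selection and
    for countability.\<close>
  proof (cases "N = \<infinity>")
    case True
    then show ?thesis
      using \<open>c > 0\<close> by (simp add: N_def \<Q>_def mult.assoc ennreal_mult_top)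
  next
    case False
    define m where "m Q = enn2real (\<mu> Q)" for Q
    have \<mu>_eq: "\<mu> Q = ennreal (m Q)" and m_pos: "0 < m Q" if "Q \<in> \<A>" for Q
      using pos_fin[of Q] that \<A>sub by (auto simp: m_def \<Q>_def enn2real_positive_iff)
    have m_sum: "sum m S \<le> enn2real N" if "finite S" "S \<subseteq> \<A>" "disjoint S" for S
    proof -
      have "ennreal (sum m S) = sum \<mu> S"
        using that \<mu>_eq m_pos by (subst sum_ennreal[symmetric]) (auto intro!: sum.cong less_imp_le)
      also have "\<dots> \<le> ennreal (enn2real N)"
        using sum_le[OF that] False by (simp add: less_top)
      finally show ?thesis by (simp add: ennreal_le_iff)
    qed
    have "{} \<notin> \<A>"
      using HL1 \<A>sub unfolding \<Q>_def all_sets_def by blast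
    \<comment> \<open>A single set is a disjoint family, so the bound on sums also bounds each
      measure uniformly.\<close>
    moreover have "m Q \<le> enn2real N" if "Q \<in> \<A>" for Q
      using m_sum[of "{Q}"] that by simp
    ultimately obtain \<D> where \<D>: "\<D> \<subseteq> \<A>" "disjoint \<D>"
      and dom: "\<And>R. R \<in> \<A> \<Longrightarrow> \<exists>Q\<in>\<D>. R \<inter> Q \<noteq> {} \<and> m R \<le> \<Lambda> * m Q"
      using maximal_dominating_disjoint_subfamily[of \<A> m "enn2real N" \<Lambda>] m_pos \<open>\<Lambda> > 1\<close> by metis
    have fin: "S \<subseteq> \<A> \<and> disjoint S" if "S \<subseteq> \<D>" for S
      using that \<D> pairwise_subset by blast
    have "countable \<D>"
      using m_pos m_sum fin \<D>(1) by (intro countable_if_finite_sums_bounded[of _ m]) auto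
    moreover have "enlargement \<Q> \<mu> \<Lambda> Q \<subseteq> X" for Q
      using HL1 by (fastforce simp: enlargement_def \<Q>_def all_sets_def)
    \<comment> \<open>Exceeding \<open>r\<close> at \<open>x\<close> is witnessed by some
      \<open>R\<close> in \<open>\<A>\<close> containing \<open>x\<close>. The set \<open>Q\<close>
      dominating \<open>R\<close> has \<open>R\<close> among the sets forming its
      enlargement.\<close>
    moreover have "{x\<in>X. maximal_fun QQ \<mu> F x > ennreal r} \<subseteq> (\<Union>Q\<in>\<D>. enlargement \<Q> \<mu> \<Lambda> Q)"
    proof safe
      fix x assume "x \<in> X" "maximal_fun QQ \<mu> F x > ennreal r"
      then obtain R where R: "R \<in> QQ x" "R \<in> \<A>"
        by (auto simp: maximal_fun_def less_SUP_iff \<A>_def \<Q>_def all_sets_def)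
      then obtain Q where Q: "Q \<in> \<D>" "R \<inter> Q \<noteq> {}" "m R \<le> \<Lambda> * m Q"
        using dom by blast
      then have "\<mu> R \<le> ennreal \<Lambda> * \<mu> Q"
        using R(2) \<D>(1) \<mu>_eq m_pos \<open>\<Lambda> > 1\<close>
        by (simp add: subset_iff ennreal_mult''[symmetric] less_imp_le ennreal_leI)
      then show "x \<in> (\<Union>Q\<in>\<D>. enlargement \<Q> \<mu> \<Lambda> Q)"
        using Q(1,2) R(2) HL1[OF \<open>x \<in> X\<close> R(1)] \<A>sub unfolding enlargement_def by blast
    qed
    moreover have "(\<Sum>Q\<in>S. \<mu> (enlargement \<Q> \<mu> \<Lambda> Q)) \<le> ennreal c * N"
      if "finite S" "S \<subseteq> \<D>" for S
    proof -
      have "(\<Sum>Q\<in>S. \<mu> (enlargement \<Q> \<mu> \<Lambda> Q)) \<le> (\<Sum>Q\<in>S. ennreal c * \<mu> Q)"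
        using enl that \<D>(1) \<A>sub by (intro sum_mono) (auto simp: \<Q>_def)
      also have "\<dots> \<le> ennreal c * N"
        using sum_le fin that by (auto simp: sum_distrib_left[symmetric] intro: mult_left_mono)
      finally show ?thesis .
    qed
    ultimately have "\<mu> {x\<in>X. maximal_fun QQ \<mu> F x > ennreal r} \<le> ennreal c * N"
      by (intro outer_measure_countable_cover_le[OF outer])
    then show ?thesis
      by (simp add: N_def \<Q>_def mult.assoc)
  qed
qed

theorem theorem10:
  fixes X :: "'a set"
    and QQ :: "'a \<Rightarrow> 'a set set"
    and \<mu> :: "'a set \<Rightarrow> ennreal"
    and c :: real
  assumes "X \<noteq> {}"
    and HL1: "\<forall>x\<in>X. QQ x \<noteq> {} \<and> (\<forall>Q\<in>QQ x. Q \<subseteq> X \<and> x \<in> Q)"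
    and HL2_outer: "outer_measure_space (Pow X) \<mu>"
    and HL2_pos_fin: "\<forall>Q\<in>all_sets X QQ. 0 < \<mu> Q \<and> \<mu> Q < \<infinity>"
    and HL3: "\<forall>Q :: nat \<Rightarrow> 'a set.
                (\<forall>n. Q n \<in> all_sets X QQ) \<longrightarrow> disjoint_family Q \<longrightarrow> 0 < (INF n. \<mu> (Q n))
                  \<longrightarrow> \<mu> (\<Union>n. Q n) = \<infinity>"
    and "c > 0"
    and HL4: "\<exists>\<Lambda>::real. \<Lambda> > 1 \<and>
                (\<forall>Q\<in>all_sets X QQ. \<mu> (enlargement (all_sets X QQ) \<mu> \<Lambda> Q) \<le> ennreal c * \<mu> Q)"
  shows "HL_maximal_constant X QQ \<mu> \<le> ennreal c"
proof -
  obtain \<Lambda> :: real where "\<Lambda> > 1"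
    and "\<And>Q. Q \<in> all_sets X QQ \<Longrightarrow> \<mu> (enlargement (all_sets X QQ) \<mu> \<Lambda> Q) \<le> ennreal c * \<mu> Q"
    using HL4 by blast
  then have "\<mu> {x\<in>X. maximal_fun QQ \<mu> F x > ennreal r}
      \<le> ennreal c * inverse (ennreal r) * set_fun_norm (all_sets X QQ) F" if "r > 0" for r F
    using HL1 HL2_outer HL2_pos_fin \<open>c > 0\<close> that by (intro maximal_inequality) auto
  \<comment> \<open>The maximal constant is an infimum, and \<open>c\<close> has just been shown to
    be admissible.\<close>
  then show ?thesis
    using \<open>c > 0\<close> unfolding HL_maximal_constant_def by (intro Inf_lower) blast
qed

end
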